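(* For every $n\ge 1$ there are isomorphisms of complex vector spaces $$\mathbb{C}[x_1,\dots,x_n]\big/(x_i^2-x_i : 1\le i\le n)\;\simeq\;(\mathbb{C}^2)^{\otimes n}\;\simeq\;\mathrm{diag}\,\mathrm{Mat}_{\mathbb{C}}(2^n),$$ where $\mathrm{diag}\,\mathrm{Mat}_{\mathbb{C}}(2^n)$ denotes the space of diagonal complex $2^n\times 2^n$ matrices.
   Context: $\mathbb{C}[x_1,\dots,x_n]/(x_i^2-x_i)$ is the quotient of the polynomial ring in $n$ indeterminates by the idempotence relations $x_i^2=x_i$ for all $i$. *)

theory Defs
  imports
    "HOL-Algebra.QuotRing"
    "HOL-Library.Poly_Mapping"
    "Jordan_Normal_Form.VS_Connect"
begin

definition vs_isomorphic ::
  "('k, 'r) ring_scheme \<Rightarrow> ('k, 'v, 'a) module_scheme \<Rightarrow> ('k, 'w, 'b) module_scheme \<Rightarrow> bool" where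
  "vs_isomorphic K V W \<longleftrightarrow>
     (\<exists>f. linear_map K V W f \<and> bij_betw f (carrier V) (carrier W))"

text \<open>The ring part of the quotient is that of \<^const>\<open>FactRing\<close>. For a coset \<open>X = N + x\<close>
  of a submodule \<open>N\<close>, all cosets \<open>N + c x'\<close> with \<open>x' \<in> X\<close> coincide, so their union below is
  the coset \<open>N + c x\<close>.\<close>

definition quot_module :: "('k, 'v, 'm) module_scheme \<Rightarrow> 'v set \<Rightarrow> ('k, 'v set) module" where
  "quot_module M N =
     \<lparr>carrier = a_rcosets\<^bsub>M\<^esub> N, mult = rcoset_mult M N, one = N +>\<^bsub>M\<^esub> \<one>\<^bsub>M\<^esub>,
      zero = N, add = set_add M,
      smult = (\<lambda>c X. \<Union>x\<in>X. N +>\<^bsub>M\<^esub> (c \<odot>\<^bsub>M\<^esub> x))\<rparr>"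

text \<open>A monomial is its finitely supported exponent function, and a polynomial is its finitely
  supported coefficient function on monomials.\<close>

definition mpoly_ring :: "nat \<Rightarrow> ('a::comm_ring_1, (nat \<Rightarrow>\<^sub>0 nat) \<Rightarrow>\<^sub>0 'a) module" where
  "mpoly_ring n =
     \<lparr>carrier = {p. \<forall>m \<in> Poly_Mapping.keys p. Poly_Mapping.keys m \<subseteq> {1..n}},
      mult = (*), one = 1, zero = 0, add = (+),
      smult = (\<lambda>c. Poly_Mapping.map ((*) c))\<rparr>"

definition indet :: "nat \<Rightarrow> (nat \<Rightarrow>\<^sub>0 nat) \<Rightarrow>\<^sub>0 'a::comm_ring_1" where
  "indet i = Poly_Mapping.single (Poly_Mapping.single i 1) 1"

definition idempotent_mpoly_quot ::
  "nat \<Rightarrow> ('a::comm_ring_1, ((nat \<Rightarrow>\<^sub>0 nat) \<Rightarrow>\<^sub>0 'a) set) module" where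
  "idempotent_mpoly_quot n =
     quot_module (mpoly_ring n) (Idl\<^bsub>mpoly_ring n\<^esub> {indet i ^ 2 - indet i | i. i \<in> {1..n}})"

text \<open>Only the additive and scalar structure of the free module is meaningful; \<open>mult\<close> and
  \<open>one\<close> are dummies demanded by the record type.\<close>

definition free_module :: "'x set \<Rightarrow> ('a::comm_ring_1, 'x \<Rightarrow>\<^sub>0 'a) module" where
  "free_module S =
     \<lparr>carrier = {f. Poly_Mapping.keys f \<subseteq> S},
      mult = (\<lambda>f g. 0), one = 0, zero = 0, add = (+),
      smult = (\<lambda>c. Poly_Mapping.map ((*) c))\<rparr>"

text \<open>The tensor power is the free module on \<open>n\<close>-tuples of vectors modulo the relations that
  make the tuple multilinear in its entries; tuples are lists of length \<open>n\<close>.\<close>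

definition tuples :: "('a, 'v, 'm) module_scheme \<Rightarrow> nat \<Rightarrow> 'v list set" where
  "tuples V n = {vs. length vs = n \<and> set vs \<subseteq> carrier V}"

definition multilinear_relations ::
  "('a::comm_ring_1, 'v, 'm) module_scheme \<Rightarrow> nat \<Rightarrow> ('v list \<Rightarrow>\<^sub>0 'a) set" where
  "multilinear_relations V n =
     {Poly_Mapping.single (vs[i := u \<oplus>\<^bsub>V\<^esub> w]) 1
        - Poly_Mapping.single (vs[i := u]) 1 - Poly_Mapping.single (vs[i := w]) 1 | vs i u w.
        vs \<in> tuples V n \<and> i < n \<and> u \<in> carrier V \<and> w \<in> carrier V} \<union>
     {Poly_Mapping.single (vs[i := c \<odot>\<^bsub>V\<^esub> u]) 1 - Poly_Mapping.single (vs[i := u]) c | vs i c u.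
        vs \<in> tuples V n \<and> i < n \<and> u \<in> carrier V}"

definition tensor_power ::
  "('a::comm_ring_1, 'v, 'm) module_scheme \<Rightarrow> nat \<Rightarrow> ('a, ('v list \<Rightarrow>\<^sub>0 'a) set) module" where
  "tensor_power V n =
     quot_module (free_module (tuples V n))
       (LinearCombinations.module.span class_ring (free_module (tuples V n))
          (multilinear_relations V n))"

definition diag_mat_space :: "'a::semiring_1 itself \<Rightarrow> nat \<Rightarrow> ('a, 'a mat) module" where
  "diag_mat_space ty d =
     (module_mat ty d d)\<lparr>carrier := {A \<in> carrier_mat d d. diagonal_mat A}\<rparr>"

end

theory Submission
  imports Defs
begin

text \<open>Both quotients are identified with the diagonal matrices through \<open>2 ^ n\<close> linear functionals,
  indexed by the subsets \<open>S\<close> of the \<open>n\<close> positions, whose common kernel is exactly what is divided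
  out.

  For polynomials the functionals are the evaluations at the vertices of the unit cube. The
  products \<open>e\<^sub>S\<close> of the \<open>x\<^sub>i\<close> with \<open>i \<in> S\<close> and the \<open>1 - x\<^sub>i\<close> with \<open>i \<notin> S\<close> sum to \<open>1\<close>, and \<open>p e\<^sub>S\<close>
  is congruent to \<open>p(S) e\<^sub>S\<close> modulo the relations \<open>x\<^sub>i\<^sup>2 - x\<^sub>i\<close>. Hence \<open>p\<close> is congruent to the sum of
  the \<open>p(S) e\<^sub>S\<close>, and lies in the ideal as soon as all \<open>p(S)\<close> vanish.

  For tensors the functionals are the coordinates with respect to the tensor products of standard
  basis vectors. Expanding a tuple multilinearly, one entry at a time, shows that modulo the
  multilinearity relations it equals the combination of basis tuples given by its coordinates.\<close>

section \<open>Isomorphisms and quotients of vector spaces\<close>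

lemma linear_mapI:
  assumes V: "vectorspace K V" and W: "vectorspace K W"
    and "\<And>v. v \<in> carrier V \<Longrightarrow> f v \<in> carrier W"
    and "\<And>v w. v \<in> carrier V \<Longrightarrow> w \<in> carrier V \<Longrightarrow> f (v \<oplus>\<^bsub>V\<^esub> w) = f v \<oplus>\<^bsub>W\<^esub> f w"
    and "\<And>c v. c \<in> carrier K \<Longrightarrow> v \<in> carrier V \<Longrightarrow> f (c \<odot>\<^bsub>V\<^esub> v) = c \<odot>\<^bsub>W\<^esub> f v"
  shows "linear_map K V W f"
proof -
  have "f \<in> LinearCombinations.module_hom K V W"
    using assms(3-5) unfolding LinearCombinations.module_hom_def by blast
  then show ?thesis
    using V W by (intro linear_map.intro mod_hom.intro mod_hom_axioms.intro vectorspace.axioms(1))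
qed

lemma vs_isomorphic_sym:
  assumes "vs_isomorphic K V W"
  shows "vs_isomorphic K W V"
proof -
  obtain f where f: "linear_map K V W f" and bij: "bij_betw f (carrier V) (carrier W)"
    using assms unfolding vs_isomorphic_def by blast
  interpret linear_map K V W f by (rule f)
  define g where "g = inv_into (carrier V) f"
  have g_carrier: "g w \<in> carrier V" and f_g: "f (g w) = w" if "w \<in> carrier W" for w
    using bij that unfolding g_def bij_betw_def
    by (auto intro: inv_into_into f_inv_into_f)
  have g_f: "g (f v) = v" if "v \<in> carrier V" for v
    using bij that unfolding g_def bij_betw_def by (auto intro: inv_into_f_f)
  have "linear_map K W V g"
  proof (rule linear_mapI)
    fix w1 w2
    assume w: "w1 \<in> carrier W" "w2 \<in> carrier W"
    have "g (w1 \<oplus>\<^bsub>W\<^esub> w2) = g (f (g w1 \<oplus>\<^bsub>V\<^esub> g w2))"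
      using w by (simp add: g_carrier f_g)
    also have "\<dots> = g w1 \<oplus>\<^bsub>V\<^esub> g w2"
      using w by (intro g_f) (simp add: g_carrier)
    finally show "g (w1 \<oplus>\<^bsub>W\<^esub> w2) = g w1 \<oplus>\<^bsub>V\<^esub> g w2" .
  next
    fix c w
    assume w: "c \<in> carrier K" "w \<in> carrier W"
    have "g (c \<odot>\<^bsub>W\<^esub> w) = g (f (c \<odot>\<^bsub>V\<^esub> g w))"
      using w by (simp add: g_carrier f_g)
    also have "\<dots> = c \<odot>\<^bsub>V\<^esub> g w"
      using w by (intro g_f) (simp add: g_carrier)
    finally show "g (c \<odot>\<^bsub>W\<^esub> w) = c \<odot>\<^bsub>V\<^esub> g w" .
  qed (use linear_map.axioms[OF f] g_carrier in blast)+
  moreover have "bij_betw g (carrier W) (carrier V)"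
    unfolding g_def by (rule bij_betw_inv_into[OF bij])
  ultimately show ?thesis
    unfolding vs_isomorphic_def by blast
qed

lemma vs_isomorphic_trans:
  assumes "vs_isomorphic K U V" and "vs_isomorphic K V W"
  shows "vs_isomorphic K U W"
proof -
  obtain f where f: "linear_map K U V f" and f_bij: "bij_betw f (carrier U) (carrier V)"
    using assms(1) unfolding vs_isomorphic_def by blast
  obtain g where g: "linear_map K V W g" and g_bij: "bij_betw g (carrier V) (carrier W)"
    using assms(2) unfolding vs_isomorphic_def by blast
  have "linear_map K U W (g \<circ> f)"
    using bij_betwE[OF f_bij] bij_betwE[OF g_bij] linear_map.axioms(1)[OF f]
      linear_map.axioms(2)[OF g]
    by (intro linear_mapI) (simp_all add: linear_map.T_add[OF f] linear_map.T_add[OF g]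
        linear_map.T_smult[OF f] linear_map.T_smult[OF g])
  then show ?thesis
    using bij_betw_trans[OF f_bij g_bij] unfolding vs_isomorphic_def by blast
qed

text \<open>First isomorphism theorem. That the quotient by the kernel is a vector space at all is
  proved along the way.\<close>

lemma vs_isomorphic_quot_module:
  assumes f: "linear_map K M W f" and surj: "f ` carrier M = carrier W"
  shows "vs_isomorphic K (quot_module M {x \<in> carrier M. f x = \<zero>\<^bsub>W\<^esub>}) W"
proof -
  have M: "vectorspace K M" and W: "vectorspace K W"
    using linear_map.axioms[OF f] by blast+
  note f_add = linear_map.T_add[OF f] and f_smult = linear_map.T_smult[OF f]
  have mod_M: "module K M" and mod_W: "module K W"
    using M W by (auto dest: vectorspace.axioms(1))
  interpret M: abelian_group M
    using mod_M by (rule module.axioms(2))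
  interpret W: abelian_group W
    using mod_W by (rule module.axioms(2))
  have f_closed: "f x \<in> carrier W" if "x \<in> carrier M" for x
    using surj that by blast
  note smult_closed = module.smult_closed[OF mod_M]
  interpret fh: abelian_group_hom M W f
    by (rule abelian_group_homI)
      (use M.abelian_group_axioms W.abelian_group_axioms f_add f_closed
        in \<open>auto simp: hom_def intro!: group_hom.intro group_hom_axioms.intro
          abelian_group.a_group\<close>)
  define N where "N = {x \<in> carrier M. f x = \<zero>\<^bsub>W\<^esub>}"
  define Q where "Q = quot_module M N"
  have N_kernel: "N = a_kernel M W f"
    unfolding N_def a_kernel_def' by simp
  interpret N: abelian_subgroup N M
    unfolding N_kernel by (rule fh.abelian_subgroup_a_kernel)
  define coset where "coset x = N +>\<^bsub>M\<^esub> x" for x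
  have carrier_Q: "carrier Q = coset ` carrier M"
    unfolding Q_def quot_module_def coset_def A_RCOSETS_def' by auto
  have zero_Q: "\<zero>\<^bsub>Q\<^esub> = coset \<zero>\<^bsub>M\<^esub>"
    using N.a_subset unfolding Q_def quot_module_def coset_def by simp
  have add_Q: "coset x \<oplus>\<^bsub>Q\<^esub> coset y = coset (x \<oplus>\<^bsub>M\<^esub> y)"
    if "x \<in> carrier M" "y \<in> carrier M" for x y
    using that N.a_rcos_sum unfolding Q_def quot_module_def coset_def by simp
  have mem_coset: "x' \<in> carrier M" "f x' = f x" if "x \<in> carrier M" "x' \<in> coset x" for x x'
  proof -
    obtain h where h: "h \<in> carrier M" "f h = \<zero>\<^bsub>W\<^esub>" "x' = h \<oplus>\<^bsub>M\<^esub> x"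
      using \<open>x' \<in> coset x\<close> unfolding coset_def a_r_coset_def' N_def by blast
    then show "x' \<in> carrier M" "f x' = f x"
      using \<open>x \<in> carrier M\<close> by simp_all
  qed
  have self_coset: "x \<in> coset x" if "x \<in> carrier M" for x
    using that N.a_rcos_self unfolding coset_def by blast
  \<comment> \<open>Cosets of the kernel are the fibres of \<open>f\<close>, so well-definedness
    below reduces to comparing values of \<open>f\<close>.\<close>
  have coset_eq: "coset x = coset y \<longleftrightarrow> f x = f y"
    if xy: "x \<in> carrier M" "y \<in> carrier M" for x y
  proof
    assume "coset x = coset y"
    then show "f x = f y"
      using self_coset mem_coset(2) xy by metis
  next
    assume "f x = f y"
    have y: "\<ominus>\<^bsub>M\<^esub> y \<in> carrier M"
      using xy by simp
    have "f (x \<oplus>\<^bsub>M\<^esub> \<ominus>\<^bsub>M\<^esub> y) = f (y \<oplus>\<^bsub>M\<^esub> \<ominus>\<^bsub>M\<^esub> y)"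
      using \<open>f x = f y\<close> f_add[OF xy(1) y] f_add[OF xy(2) y] by metis
    also have "\<dots> = \<zero>\<^bsub>W\<^esub>"
      using M.r_neg[OF xy(2)] fh.hom_zero by metis
    finally have "x \<oplus>\<^bsub>M\<^esub> \<ominus>\<^bsub>M\<^esub> y \<in> N"
      using M.add.m_closed[OF xy(1) y] unfolding N_def by blast
    moreover have "x = (x \<oplus>\<^bsub>M\<^esub> \<ominus>\<^bsub>M\<^esub> y) \<oplus>\<^bsub>M\<^esub> y"
      using M.a_assoc[OF xy(1) y xy(2)] M.l_neg[OF xy(2)] M.r_zero[OF xy(1)] by metis
    ultimately have "x \<in> coset y"
      unfolding coset_def a_r_coset_def' by blast
    then show "coset x = coset y"
      using N.a_repr_independence' xy unfolding coset_def by blast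
  qed
  have smult_Q: "c \<odot>\<^bsub>Q\<^esub> coset x = coset (c \<odot>\<^bsub>M\<^esub> x)"
    if c: "c \<in> carrier K" and x: "x \<in> carrier M" for c x
  proof -
    have "coset (c \<odot>\<^bsub>M\<^esub> x') = coset (c \<odot>\<^bsub>M\<^esub> x)" if "x' \<in> coset x" for x'
      using mem_coset[OF x that] c x by (simp add: coset_eq smult_closed f_smult)
    then have "(\<Union>x'\<in>coset x. coset (c \<odot>\<^bsub>M\<^esub> x')) = coset (c \<odot>\<^bsub>M\<^esub> x)"
      using self_coset[OF x] by blast
    then show ?thesis
      unfolding Q_def quot_module_def coset_def by simp
  qed
  have neg_Q: "\<exists>w\<in>carrier Q. v \<oplus>\<^bsub>Q\<^esub> w = \<zero>\<^bsub>Q\<^esub>" if v: "v \<in> carrier Q" for v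
  proof -
    obtain x where x: "x \<in> carrier M" "v = coset x"
      using v unfolding carrier_Q by blast
    then have "coset (\<ominus>\<^bsub>M\<^esub> x) \<in> carrier Q \<and> v \<oplus>\<^bsub>Q\<^esub> coset (\<ominus>\<^bsub>M\<^esub> x) = \<zero>\<^bsub>Q\<^esub>"
      by (simp add: carrier_Q zero_Q add_Q M.r_neg)
    then show ?thesis by blast
  qed
  interpret K: cring K
    using mod_M by (rule module.axioms(1))
  have Q: "vectorspace K Q"
    by (rule vs_criteria)
      (use neg_Q in \<open>auto simp: carrier_Q zero_Q add_Q smult_Q vectorspace.axioms(2)[OF M]
        M.a_ac smult_closed module.smult_assoc1[OF mod_M] module.smult_l_distr[OF mod_M]
        module.smult_r_distr[OF mod_M] module.smult_one[OF mod_M]\<close>)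
  \<comment> \<open>Any representative serves, because \<open>f\<close> is constant on each
    coset.\<close>
  define g where "g X = f (SOME x. x \<in> X)" for X
  have g_coset: "g (coset x) = f x" if "x \<in> carrier M" for x
    unfolding g_def
    using mem_coset(2)[OF that] someI[of "\<lambda>x'. x' \<in> coset x", OF self_coset[OF that]]
    by blast
  have "linear_map K Q W g"
    by (rule linear_mapI[OF Q W])
      (auto simp: carrier_Q add_Q smult_Q g_coset f_add f_smult smult_closed)
  moreover have "inj_on g (carrier Q)"
    by (auto simp: inj_on_def carrier_Q g_coset coset_eq)
  moreover have "g ` carrier Q = carrier W"
    unfolding carrier_Q image_image using g_coset surj by (metis (no_types, lifting) image_cong)
  ultimately show ?thesis
    unfolding vs_isomorphic_def bij_betw_def Q_def N_def by blast
qed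

section \<open>Diagonal matrices as a coordinate space\<close>

lemma vectorspace_diag_mat_space:
  "vectorspace (class_ring :: 'a::field ring) (diag_mat_space TYPE('a) d)"
proof -
  interpret vectorspace "class_ring :: 'a ring" "module_mat TYPE('a) d d"
    by (rule matrix_vs)
  have "subspace class_ring {A \<in> carrier_mat d d. diagonal_mat A} (module_mat TYPE('a) d d)"
    by (intro subspace.intro submodule.intro vectorspace_axioms module_axioms)
      (auto simp: module_mat_simps diagonal_mat_def)
  then show ?thesis
    unfolding diag_mat_space_def by (rule subspace_is_vs)
qed

text \<open>Writing the values of the functionals along the diagonal gives a linear map whose kernel
  is their common kernel. It is onto by \<open>surj\<close>, which lets the functionals take
  arbitrary prescribed values simultaneously.\<close>

lemma vs_isomorphic_quot_module_diag_mat_space: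
  fixes \<phi> :: "'i \<Rightarrow> 'v \<Rightarrow> 'a::field"
  assumes V: "vectorspace (class_ring :: 'a ring) V"
    and I: "finite I" "card I = d"
    and add: "\<And>i v w. v \<in> carrier V \<Longrightarrow> w \<in> carrier V \<Longrightarrow> \<phi> i (v \<oplus>\<^bsub>V\<^esub> w) = \<phi> i v + \<phi> i w"
    and smult: "\<And>i c v. v \<in> carrier V \<Longrightarrow> \<phi> i (c \<odot>\<^bsub>V\<^esub> v) = c * \<phi> i v"
    and surj: "\<And>a. \<exists>v\<in>carrier V. \<forall>i\<in>I. \<phi> i v = a i"
  shows "vs_isomorphic class_ring (quot_module V {v \<in> carrier V. \<forall>i\<in>I. \<phi> i v = 0})
           (diag_mat_space TYPE('a) d)"
proof -
  let ?D = "diag_mat_space TYPE('a) d"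
  have D: "vectorspace (class_ring :: 'a ring) ?D" by (rule vectorspace_diag_mat_space)
  have D_simps: "carrier ?D = {A \<in> carrier_mat d d. diagonal_mat A}"
    "(\<oplus>\<^bsub>?D\<^esub>) = (+)" "\<zero>\<^bsub>?D\<^esub> = 0\<^sub>m d d" "(\<odot>\<^bsub>?D\<^esub>) = (\<cdot>\<^sub>m)"
    by (auto simp: diag_mat_space_def module_mat_simps)
  obtain h where h: "bij_betw h {0..<d} I"
    using ex_bij_betw_nat_finite I by metis
  \<comment> \<open>\<open>h\<close> enumerates \<open>I\<close> along the diagonal;
    \<open>h'\<close> turns the diagonal entries of a given matrix into prescribed values indexed by
    \<open>I\<close>.\<close>
  define h' where "h' = inv_into {0..<d} h"
  have h'_h: "h' (h k) = k" if "k < d" for k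
    using h that unfolding h'_def bij_betw_def by (intro inv_into_f_f) auto
  have ball_I: "(\<forall>i\<in>I. P i) \<longleftrightarrow> (\<forall>k<d. P (h k))" for P
    using h unfolding bij_betw_def by auto
  define f where "f v = mat d d (\<lambda>(i, j). if i = j then \<phi> (h i) v else 0)" for v
  have f_carrier: "f v \<in> carrier ?D" for v
    by (auto simp: f_def D_simps diagonal_mat_def)
  have "linear_map class_ring V ?D f"
    by (intro linear_mapI V D f_carrier) (auto simp: f_def add smult D_simps)
  moreover have "f ` carrier V = carrier ?D"
  proof (intro equalityI image_subsetI f_carrier subsetI)
    fix A
    assume A: "A \<in> carrier ?D"
    obtain v where v: "v \<in> carrier V" "\<forall>k<d. \<phi> (h k) v = A $$ (k, k)"
      using surj[of "\<lambda>i. A $$ (h' i, h' i)"] h'_h by (auto simp: ball_I)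
    have "A = f v"
      using A v(2) by (intro eq_matI) (auto simp: f_def D_simps diagonal_mat_def)
    then show "A \<in> f ` carrier V"
      using v(1) by blast
  qed
  ultimately have "vs_isomorphic class_ring (quot_module V {v \<in> carrier V. f v = \<zero>\<^bsub>?D\<^esub>}) ?D"
    by (rule vs_isomorphic_quot_module)
  moreover have "f v = \<zero>\<^bsub>?D\<^esub> \<longleftrightarrow> (\<forall>i\<in>I. \<phi> i v = 0)" for v
    by (auto simp: f_def D_simps mat_eq_iff ball_I)
  ultimately show ?thesis by simp
qed

section \<open>Linear extension to finitely supported functions\<close>

abbreviation scale :: "'a \<Rightarrow> ('x \<Rightarrow>\<^sub>0 'a) \<Rightarrow> ('x \<Rightarrow>\<^sub>0 'a::comm_ring_1)" where
  "scale c \<equiv> Poly_Mapping.map ((*) c)"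

lemma lookup_scale: "Poly_Mapping.lookup (scale c p) x = c * Poly_Mapping.lookup p x"
  by (simp add: Poly_Mapping.map.rep_eq when_def)

lemma scale_add_left: "scale (c + d) p = scale c p + scale d p"
  and scale_add_right: "scale c (p + q) = scale c p + scale c q"
  and scale_diff_right: "scale c (p - q) = scale c p - scale c q"
  and scale_scale: "scale c (scale d p) = scale (c * d) p"
  and scale_one: "scale 1 p = p"
  by (rule poly_mapping_eqI; simp add: lookup_scale lookup_add lookup_minus algebra_simps)+

lemma scale_sum: "scale c (\<Sum>x\<in>A. p x) = (\<Sum>x\<in>A. scale c (p x))"
  by (rule poly_mapping_eqI) (simp add: lookup_scale lookup_sum sum_distrib_left)

lemma scale_single: "scale c (Poly_Mapping.single x a) = Poly_Mapping.single x (c * a)"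
  by (rule poly_mapping_eqI) (simp add: lookup_scale lookup_single when_def)

lemma keys_scale: "Poly_Mapping.keys (scale c p) \<subseteq> Poly_Mapping.keys p"
  by (auto simp: in_keys_iff lookup_scale)

text \<open>Additive form of \<open>update_induct\<close>. Since the key \<open>a\<close> is new,
  nothing cancels, so by \<open>keys_single_add\<close> membership of the sum in a carrier passes to
  both summands.\<close>

lemma poly_mapping_induct [case_names zero add]:
  assumes "P 0"
    and "\<And>f a b. a \<notin> Poly_Mapping.keys f \<Longrightarrow> b \<noteq> 0 \<Longrightarrow> P f \<Longrightarrow>
      P (Poly_Mapping.single a b + f)"
  shows "P f"
proof (induction f rule: update_induct)
  case (update f a b)
  have "Poly_Mapping.update a b f = Poly_Mapping.single a b + f"
    using update(1) by (intro poly_mapping_eqI)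
      (auto simp: lookup_update lookup_add lookup_single when_def in_keys_iff)
  then show ?case
    using assms(2) update by simp
qed (rule assms(1))

lemma keys_single_add:
  "a \<notin> Poly_Mapping.keys f \<Longrightarrow> b \<noteq> 0 \<Longrightarrow>
    Poly_Mapping.keys (Poly_Mapping.single a b + f) = insert a (Poly_Mapping.keys f)"
  by (auto simp: in_keys_iff lookup_add lookup_single when_def split: if_splits)

text \<open>Extension by linearity from basis elements to the free module. Below, \<open>h\<close>
  is either the coordinate of a tuple or the value of a monomial at a vertex.\<close>

definition linear_ext :: "('x \<Rightarrow> 'a) \<Rightarrow> ('x \<Rightarrow>\<^sub>0 'a::comm_ring_1) \<Rightarrow> 'a" where
  "linear_ext h p = (\<Sum>x\<in>Poly_Mapping.keys p. Poly_Mapping.lookup p x * h x)"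

text \<open>The extra terms are zero. Additivity needs this to sum \<open>p\<close>,
  \<open>q\<close> and \<open>p + q\<close> over a common set.\<close>

lemma linear_ext_superset:
  "finite A \<Longrightarrow> Poly_Mapping.keys p \<subseteq> A \<Longrightarrow>
    linear_ext h p = (\<Sum>x\<in>A. Poly_Mapping.lookup p x * h x)"
  unfolding linear_ext_def by (rule sum.mono_neutral_left) (auto simp: in_keys_iff)

lemma linear_ext_zero [simp]: "linear_ext h 0 = 0"
  by (simp add: linear_ext_def)

lemma linear_ext_single [simp]: "linear_ext h (Poly_Mapping.single x a) = a * h x"
  by (simp add: linear_ext_def)

lemma linear_ext_one: "linear_ext h 1 = h 0"
  using linear_ext_single[of h 0 1] by simp

lemma linear_ext_scale: "linear_ext h (scale c p) = c * linear_ext h p"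
  by (subst linear_ext_superset[OF finite_keys keys_scale])
    (simp add: linear_ext_def lookup_scale sum_distrib_left mult.assoc)

lemma linear_ext_add: "linear_ext h (p + q) = linear_ext h p + linear_ext h q"
proof -
  have "linear_ext h r = (\<Sum>x\<in>Poly_Mapping.keys p \<union> Poly_Mapping.keys q. Poly_Mapping.lookup r x * h x)"
    if "Poly_Mapping.keys r \<subseteq> Poly_Mapping.keys p \<union> Poly_Mapping.keys q" for r
    using that by (intro linear_ext_superset) auto
  then show ?thesis
    using Poly_Mapping.keys_add[of p q] by (simp add: lookup_add distrib_right sum.distrib)
qed

lemma linear_ext_diff: "linear_ext h (p - q) = linear_ext h p - linear_ext h q"
  using linear_ext_add[of h "p - q" q] by simp

lemma linear_ext_sum: "linear_ext h (\<Sum>x\<in>A. p x) = (\<Sum>x\<in>A. linear_ext h (p x))"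
  by (induction A rule: infinite_finite_induct) (simp_all add: linear_ext_add)

text \<open>Both sides are additive in \<open>p\<close> and in \<open>q\<close>, and on single terms
  the claim is the hypothesis on \<open>h\<close>, because multiplying monomials adds their
  keys.\<close>

lemma linear_ext_mult:
  assumes "\<And>x y. h (x + y) = h x * h y"
  shows "linear_ext h (p * q) = linear_ext h p * linear_ext h q"
proof (induction p rule: poly_mapping_induct)
  case (add f a b)
  have "linear_ext h (Poly_Mapping.single a b * q) = b * h a * linear_ext h q"
    by (induction q rule: poly_mapping_induct)
      (simp_all add: linear_ext_add distrib_left mult_single assms)
  then show ?case
    using add by (simp add: linear_ext_add distrib_right)
qed simp

section \<open>Tensor powers\<close>

lemma free_module_simps:
  "carrier (free_module S) = {f. Poly_Mapping.keys f \<subseteq> S}" "(\<oplus>\<^bsub>free_module S\<^esub>) = (+)"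
  "\<zero>\<^bsub>free_module S\<^esub> = 0" "(\<odot>\<^bsub>free_module S\<^esub>) = scale"
  by (simp_all add: free_module_def)

lemma vectorspace_free_module:
  fixes S :: "'x set"
  shows "vectorspace (class_ring :: 'a::field ring) (free_module S)"
proof (rule vs_criteria)
  let ?F = "free_module S :: ('a, 'x \<Rightarrow>\<^sub>0 'a) module"
  show "\<forall>v\<in>carrier ?F. \<exists>w\<in>carrier ?F.
      v \<oplus>\<^bsub>?F\<^esub> w = \<zero>\<^bsub>?F\<^esub>"
    unfolding free_module_simps
  proof (intro ballI)
    fix v :: "'x \<Rightarrow>\<^sub>0 'a"
    assume "v \<in> {f. Poly_Mapping.keys f \<subseteq> S}"
    then have "- v \<in> {f. Poly_Mapping.keys f \<subseteq> S} \<and> v + - v = 0"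
      by (simp add: subset_iff in_keys_iff)
    then show "\<exists>w\<in>{f. Poly_Mapping.keys f \<subseteq> S}. v + w = 0"
      by blast
  qed
  show "\<forall>v w. v \<in> carrier ?F \<and> w \<in> carrier ?F \<longrightarrow>
      v \<oplus>\<^bsub>?F\<^esub> w \<in> carrier ?F"
    by (simp add: free_module_simps subset_trans[OF Poly_Mapping.keys_add])
  show "\<forall>c v. c \<in> carrier (class_ring :: 'a ring) \<and> v \<in> carrier ?F \<longrightarrow>
      c \<odot>\<^bsub>?F\<^esub> v \<in> carrier ?F"
    by (simp add: free_module_simps subset_trans[OF keys_scale])
qed (simp_all add: class_field free_module_simps scale_scale scale_one scale_add_left
    scale_add_right add_ac)

locale binary_tensor_power =
  fixes n :: nat and ty :: "'a::field itself"
begin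

abbreviation V where "V \<equiv> module_vec TYPE('a) 2"
abbreviation F :: "('a, 'a vec list \<Rightarrow>\<^sub>0 'a) module" where
  "F \<equiv> free_module (tuples V n)"
abbreviation N where
  "N \<equiv> LinearCombinations.module.span class_ring F (multilinear_relations V n)"

text \<open>A set \<open>S\<close> of positions encodes a 0/1 word: position \<open>i\<close>
  carries index 1 if \<open>i \<in> S\<close> and index 0 otherwise. The product is the coefficient
  of the basis tensor given by \<open>basis_tuple S\<close> in the pure tensor with entries
  \<open>vs\<close>.\<close>

definition tensor_coord :: "nat set \<Rightarrow> 'a vec list \<Rightarrow> 'a" where
  "tensor_coord S vs = (\<Prod>i<n. vs ! i $ of_bool (i \<in> S))"

definition basis_tuple :: "nat set \<Rightarrow> 'a vec list" where
  "basis_tuple S = map (\<lambda>i. unit_vec 2 (of_bool (i \<in> S))) [0..<n]"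

lemma V_simps: "carrier V = carrier_vec 2" "(\<oplus>\<^bsub>V\<^esub>) = (+)" "(\<odot>\<^bsub>V\<^esub>) = (\<cdot>\<^sub>v)"
  by (simp_all add: module_vec_simps)

lemma of_bool_less_2: "of_bool b < (2::nat)"
  by (cases b) auto

lemma tuples_update: "vs \<in> tuples V n \<Longrightarrow> u \<in> carrier_vec 2 \<Longrightarrow> vs[i := u] \<in> tuples V n"
  using set_update_subset_insert[of vs i u] by (auto simp: tuples_def V_simps)

lemma basis_tuple_in_tuples: "basis_tuple S \<in> tuples V n"
  by (auto simp: tuples_def basis_tuple_def V_simps)

text \<open>The remaining product does not involve \<open>u\<close>, so each coordinate is linear in
  every single entry of the tuple.\<close>

lemma tensor_coord_update:
  assumes "vs \<in> tuples V n" "i < n"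
  shows "tensor_coord S (vs[i := u]) =
    u $ of_bool (i \<in> S) * (\<Prod>j\<in>{..<n} - {i}. vs ! j $ of_bool (j \<in> S))"
  unfolding tensor_coord_def using assms
  by (subst prod.remove[of _ i]) (auto simp: tuples_def intro!: arg_cong2[of _ _ _ _ "(*)"] prod.cong)

text \<open>Duality of coordinates and basis tuples: the factor at \<open>i\<close> is 1 or 0
  according to whether \<open>S\<close> and \<open>T\<close> agree there.\<close>

lemma tensor_coord_basis_tuple:
  assumes "S \<subseteq> {..<n}" "T \<subseteq> {..<n}"
  shows "tensor_coord S (basis_tuple T) = of_bool (S = T)"
proof -
  have "tensor_coord S (basis_tuple T) = (\<Prod>i<n. of_bool ((i \<in> S) = (i \<in> T)))"
    unfolding tensor_coord_def basis_tuple_def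
    by (intro prod.cong) (auto simp: of_bool_less_2)
  also have "\<dots> = of_bool (\<forall>i<n. (i \<in> S) = (i \<in> T))"
    by (auto intro: prod.neutral)
  also have "(\<forall>i<n. (i \<in> S) = (i \<in> T)) \<longleftrightarrow> S = T"
    using assms by blast
  finally show ?thesis .
qed

section \<open>The span of the multilinearity relations\<close>

lemma relations_subset: "multilinear_relations V n \<subseteq> carrier F"
  unfolding multilinear_relations_def free_module_simps
  by (auto simp: in_keys_iff lookup_minus lookup_single when_def tuples_update V_simps
      split: if_splits)

lemma submodule_N: "submodule class_ring N F"
  using vectorspace_free_module[of "tuples V n"] relations_subset
  by (intro module.span_is_submodule vectorspace.axioms(1))

lemma N_add: "p \<in> N \<Longrightarrow> q \<in> N \<Longrightarrow> p + q \<in> N"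
  and N_scale: "p \<in> N \<Longrightarrow> scale c p \<in> N"
  and N_zero: "0 \<in> N"
  using submodule.m_closed[OF submodule_N] submodule.smult_closed[OF submodule_N]
    submodule.zero_closed[OF submodule_N] by (simp_all add: free_module_simps)

lemma relations_subset_N: "multilinear_relations V n \<subseteq> N"
  using vectorspace_free_module[of "tuples V n"] relations_subset
  by (intro module.in_own_span vectorspace.axioms(1))

lemma add_relation_in_N:
  assumes "vs \<in> tuples V n" "i < n" "u \<in> carrier_vec 2" "w \<in> carrier_vec 2"
  shows "Poly_Mapping.single (vs[i := u + w]) 1 - Poly_Mapping.single (vs[i := u]) 1
    - Poly_Mapping.single (vs[i := w]) 1 \<in> N"
  using relations_subset_N assms unfolding multilinear_relations_def V_simps by blast

lemma smult_relation_in_N: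
  assumes "vs \<in> tuples V n" "i < n" "u \<in> carrier_vec 2"
  shows "Poly_Mapping.single (vs[i := c \<cdot>\<^sub>v u]) 1 - Poly_Mapping.single (vs[i := u]) c \<in> N"
  using relations_subset_N assms unfolding multilinear_relations_def V_simps by blast

text \<open>Membership of this difference in \<open>N\<close> says that modulo the relations the
  tuple equals its coordinate expansion.\<close>

definition expansion_error :: "'a vec list \<Rightarrow> 'a vec list \<Rightarrow>\<^sub>0 'a" where
  "expansion_error vs = Poly_Mapping.single vs 1
    - (\<Sum>S\<in>Pow {..<n}. Poly_Mapping.single (basis_tuple S) (tensor_coord S vs))"

lemma expansion_error_basis_tuple: "S \<subseteq> {..<n} \<Longrightarrow> expansion_error (basis_tuple S) = 0"
  unfolding expansion_error_def
  by (simp add: tensor_coord_basis_tuple sum.remove[of "Pow {..<n}" S])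

text \<open>Induction on the number of entries that are not standard basis vectors. Expanding such
  an entry trades the tuple for two tuples with one such entry fewer.\<close>

lemma expansion_error_in_N: "vs \<in> tuples V n \<Longrightarrow> expansion_error vs \<in> N"
proof (induction "card {i. i < n \<and> vs ! i \<noteq> unit_vec 2 0 \<and> vs ! i \<noteq> unit_vec 2 1}"
    arbitrary: vs rule: less_induct)
  case less
  let ?e = "unit_vec 2 :: nat \<Rightarrow> 'a vec"
  let ?bad = "\<lambda>vs. {i. i < n \<and> vs ! i \<noteq> ?e 0 \<and> vs ! i \<noteq> ?e 1}"
  have len: "length vs = n"
    using less.prems by (simp add: tuples_def)
  show ?case
  proof (cases "?bad vs = {}")
    case True
    \<comment> \<open>The tuple is now a basis tuple; \<open>S\<close> collects the positions
      holding the second basis vector.\<close>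
    define S where "S = {i. i < n \<and> vs ! i = ?e 1}"
    have "vs = basis_tuple S"
      using True len by (intro nth_equalityI) (auto simp: basis_tuple_def S_def)
    moreover have "S \<subseteq> {..<n}"
      by (auto simp: S_def)
    ultimately show ?thesis
      using expansion_error_basis_tuple N_zero by metis
  next
    case False
    then obtain i where i: "i < n" "vs ! i \<noteq> ?e 0" "vs ! i \<noteq> ?e 1"
      by blast
    define u where "u = vs ! i"
    have u: "u \<in> carrier_vec 2"
      using less.prems i(1) by (auto simp: u_def tuples_def V_simps)
    have "u = u $ 0 \<cdot>\<^sub>v ?e 0 + u $ 1 \<cdot>\<^sub>v ?e 1"
      using u by (intro eq_vecI) (auto simp: less_2_cases_iff)
    then have vs_eq: "vs = vs[i := u $ 0 \<cdot>\<^sub>v ?e 0 + u $ 1 \<cdot>\<^sub>v ?e 1]"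
      by (metis list_update_id u_def)
    have IH: "expansion_error (vs[i := ?e k]) \<in> N" if "k < 2" for k
    proof (rule less.hyps)
      have "?bad (vs[i := ?e k]) = ?bad vs - {i}"
        using that i(1) len by (auto simp: nth_list_update less_2_cases_iff)
      moreover have "i \<in> ?bad vs"
        using i by simp
      ultimately show "card (?bad (vs[i := ?e k])) < card (?bad vs)"
        by (simp only:) (intro card_Diff1_less finite_Collect_conjI disjI1 finite_Collect_less_nat)
      show "vs[i := ?e k] \<in> tuples V n"
        using less.prems by (simp add: tuples_update)
    qed
    \<comment> \<open>\<open>r\<close> is the additivity relation and \<open>r' k\<close> a
      homogeneity relation at position \<open>i\<close>. Summed, they give the tuple minus the
      combination of the two replaced tuples with coefficients \<open>u $ 0\<close> and
      \<open>u $ 1\<close>; adding the scaled errors of the latter leaves the error of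
      \<open>vs\<close>.\<close>
    define r where "r = Poly_Mapping.single (vs[i := u $ 0 \<cdot>\<^sub>v ?e 0 + u $ 1 \<cdot>\<^sub>v ?e 1]) 1
      - Poly_Mapping.single (vs[i := u $ 0 \<cdot>\<^sub>v ?e 0]) 1
      - Poly_Mapping.single (vs[i := u $ 1 \<cdot>\<^sub>v ?e 1]) (1::'a)"
    define r' where "r' k = Poly_Mapping.single (vs[i := u $ k \<cdot>\<^sub>v ?e k]) 1
      - Poly_Mapping.single (vs[i := ?e k]) (u $ k)" for k
    have "tensor_coord S vs = u $ 0 * tensor_coord S (vs[i := ?e 0])
        + u $ 1 * tensor_coord S (vs[i := ?e 1])" for S
      by (subst vs_eq) (simp add: tensor_coord_update[OF less.prems i(1)] of_bool_less_2 algebra_simps)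
    then have "expansion_error vs = r + r' 0 + r' 1 + scale (u $ 0) (expansion_error (vs[i := ?e 0]))
        + scale (u $ 1) (expansion_error (vs[i := ?e 1]))"
      unfolding expansion_error_def r_def r'_def vs_eq[symmetric]
      by (simp add: scale_diff_right scale_sum scale_single single_add sum.distrib)
    moreover have "r \<in> N"
      unfolding r_def using less.prems i(1) by (intro add_relation_in_N) auto
    moreover have "r' k \<in> N" for k
      unfolding r'_def using less.prems i(1) by (intro smult_relation_in_N) auto
    ultimately show ?thesis
      using IH by (simp add: N_add N_scale)
  qed
qed

text \<open>The difference is linear in \<open>p\<close>, so the expansion of single tuples
  suffices.\<close>

lemma expansion_in_N:
  assumes "p \<in> carrier F"
  shows "p - (\<Sum>S\<in>Pow {..<n}.
    Poly_Mapping.single (basis_tuple S) (linear_ext (tensor_coord S) p)) \<in> N"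
  using assms
proof (induction p rule: poly_mapping_induct)
  case (add p vs c)
  let ?B = "\<lambda>p. \<Sum>S\<in>Pow {..<n}. Poly_Mapping.single (basis_tuple S) (linear_ext (tensor_coord S) p)"
  have mem: "vs \<in> tuples V n" "p \<in> carrier F"
    using add.prems keys_single_add[OF add.hyps] by (auto simp: free_module_simps)
  have "Poly_Mapping.single vs c + p - ?B (Poly_Mapping.single vs c + p)
      = scale c (expansion_error vs) + (p - ?B p)"
    by (simp add: expansion_error_def linear_ext_add scale_diff_right scale_sum scale_single
        single_add sum.distrib)
  then show ?case
    by (simp only: N_add[OF N_scale[OF expansion_error_in_N[OF mem(1)]] add.IH[OF mem(2)]])
qed (simp add: N_zero)

text \<open>The coordinates vanish on the relations by linearity in every entry, and their common
  kernel is a submodule, hence contains the span. Conversely, if all coordinates of \<open>p\<close>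
  vanish, \<open>expansion_in_N\<close> leaves \<open>p\<close> itself.\<close>

lemma N_eq: "N = {p \<in> carrier F. \<forall>S\<in>Pow {..<n}. linear_ext (tensor_coord S) p = 0}"
    (is "_ = ?K")
proof
  have "submodule (class_ring :: 'a ring) ?K F"
  proof (rule submodule.intro)
    show "module (class_ring :: 'a ring) F"
      using vectorspace_free_module[of "tuples V n"] by (intro vectorspace.axioms(1))
    show "v \<oplus>\<^bsub>F\<^esub> w \<in> ?K" if "v \<in> ?K" "w \<in> ?K" for v w
      using that subset_trans[OF Poly_Mapping.keys_add, of v w "tuples V n"]
      by (simp add: free_module_simps linear_ext_add)
    show "c \<odot>\<^bsub>F\<^esub> v \<in> ?K" if "v \<in> ?K" for c v
      using that subset_trans[OF keys_scale, of v "tuples V n" c]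
      by (simp add: free_module_simps linear_ext_scale)
  qed (simp_all add: free_module_simps subset_iff)
  moreover have "multilinear_relations V n \<subseteq> ?K"
  proof -
    have "linear_ext (tensor_coord S) p = 0" if "p \<in> multilinear_relations V n" for S p
      using that unfolding multilinear_relations_def V_simps
      by (auto simp: linear_ext_diff tensor_coord_update of_bool_less_2 carrier_vecD
          distrib_right mult.assoc)
    then show ?thesis
      using relations_subset by blast
  qed
  ultimately show "N \<subseteq> ?K"
    using vectorspace_free_module[of "tuples V n"]
    by (intro module.span_is_subset vectorspace.axioms(1))
  show "?K \<subseteq> N"
  proof
    fix p
    assume "p \<in> ?K"
    then show "p \<in> N"
      using expansion_in_N[of p] by simp
  qed
qed

lemma vs_isomorphic_tensor_power_diag:
  "vs_isomorphic class_ring (tensor_power V n) (diag_mat_space TYPE('a) (2 ^ n))"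
  unfolding tensor_power_def N_eq
proof (rule vs_isomorphic_quot_module_diag_mat_space)
  fix a :: "nat set \<Rightarrow> 'a"
  \<comment> \<open>By duality this combination of basis tuples has coordinate \<open>a S\<close> at
    \<open>S\<close>.\<close>
  define v where "v = (\<Sum>S\<in>Pow {..<n}. Poly_Mapping.single (basis_tuple S) (a S))"
  have "Poly_Mapping.keys v \<subseteq> tuples V n"
    unfolding v_def
    by (rule subset_trans[OF Poly_Mapping.keys_sum]) (auto simp: basis_tuple_in_tuples)
  moreover have "linear_ext (tensor_coord S) v = a S" if "S \<in> Pow {..<n}" for S
  proof -
    have "linear_ext (tensor_coord S) v = (\<Sum>T\<in>Pow {..<n}. if S = T then a T else 0)"
      unfolding v_def linear_ext_sum using that
      by (intro sum.cong) (auto simp: tensor_coord_basis_tuple)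
    then show ?thesis
      using that by simp
  qed
  ultimately show "\<exists>v\<in>carrier F. \<forall>S\<in>Pow {..<n}. linear_ext (tensor_coord S) v = a S"
    by (auto simp: free_module_simps)
qed (use vectorspace_free_module in
    \<open>auto simp: card_Pow free_module_simps linear_ext_add linear_ext_scale\<close>)

end

section \<open>Polynomials modulo the idempotence relations\<close>

lemma mpoly_ring_simps:
  "carrier (mpoly_ring n) = {p. \<forall>m\<in>Poly_Mapping.keys p. Poly_Mapping.keys m \<subseteq> {1..n}}"
  "(\<otimes>\<^bsub>mpoly_ring n\<^esub>) = (*)" "\<one>\<^bsub>mpoly_ring n\<^esub> = 1"
  "(\<oplus>\<^bsub>mpoly_ring n\<^esub>) = (+)" "\<zero>\<^bsub>mpoly_ring n\<^esub> = 0" "(\<odot>\<^bsub>mpoly_ring n\<^esub>) = scale"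
  by (simp_all add: mpoly_ring_def)

section \<open>The polynomial ring in the chosen indeterminates\<close>

lemma mpoly_carrier_add:
  "p \<in> carrier (mpoly_ring n) \<Longrightarrow> q \<in> carrier (mpoly_ring n) \<Longrightarrow> p + q \<in> carrier (mpoly_ring n)"
  using Poly_Mapping.keys_add[of p q] unfolding mpoly_ring_simps by blast

lemma mpoly_carrier_mult:
  assumes "p \<in> carrier (mpoly_ring n)" "q \<in> carrier (mpoly_ring n)"
  shows "p * q \<in> carrier (mpoly_ring n)"
  unfolding mpoly_ring_simps mem_Collect_eq
proof
  fix m
  assume "m \<in> Poly_Mapping.keys (p * q)"
  then obtain a b where "a \<in> Poly_Mapping.keys p" "b \<in> Poly_Mapping.keys q" "m = a + b"
    using keys_mult[of p q] by blast
  then show "Poly_Mapping.keys m \<subseteq> {1..n}"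
    using assms Poly_Mapping.keys_add[of a b] unfolding mpoly_ring_simps by blast
qed

lemma mpoly_carrier_uminus: "p \<in> carrier (mpoly_ring n) \<Longrightarrow> - p \<in> carrier (mpoly_ring n)"
  by (simp add: mpoly_ring_simps in_keys_iff)

lemma mpoly_carrier_single:
  "Poly_Mapping.keys m \<subseteq> {1..n} \<Longrightarrow> Poly_Mapping.single m c \<in> carrier (mpoly_ring n)"
  by (simp add: mpoly_ring_simps)

lemma mpoly_carrier_diff:
  "p \<in> carrier (mpoly_ring n) \<Longrightarrow> q \<in> carrier (mpoly_ring n) \<Longrightarrow> p - q \<in> carrier (mpoly_ring n)"
  using mpoly_carrier_add[OF _ mpoly_carrier_uminus, of p n q] by simp

lemma mpoly_carrier_scale: "p \<in> carrier (mpoly_ring n) \<Longrightarrow> scale c p \<in> carrier (mpoly_ring n)"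
  using keys_scale[of c p] unfolding mpoly_ring_simps by blast

lemma mpoly_carrier_zero: "0 \<in> carrier (mpoly_ring n)"
  and mpoly_carrier_one: "1 \<in> carrier (mpoly_ring n)"
  by (simp_all add: mpoly_ring_simps)

lemma mpoly_carrier_indet: "i \<in> {1..n} \<Longrightarrow> indet i \<in> carrier (mpoly_ring n)"
  unfolding indet_def by (intro mpoly_carrier_single) simp

lemmas mpoly_carrier_intros = mpoly_carrier_add mpoly_carrier_mult mpoly_carrier_uminus
  mpoly_carrier_single mpoly_carrier_diff mpoly_carrier_scale mpoly_carrier_zero
  mpoly_carrier_one mpoly_carrier_indet

lemma mpoly_carrier_sum:
  "(\<And>x. x \<in> A \<Longrightarrow> p x \<in> carrier (mpoly_ring n)) \<Longrightarrow> (\<Sum>x\<in>A. p x) \<in> carrier (mpoly_ring n)"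
  by (induction A rule: infinite_finite_induct) (simp_all add: mpoly_carrier_intros)

lemma mpoly_carrier_prod:
  "(\<And>x. x \<in> A \<Longrightarrow> p x \<in> carrier (mpoly_ring n)) \<Longrightarrow> (\<Prod>x\<in>A. p x) \<in> carrier (mpoly_ring n)"
  by (induction A rule: infinite_finite_induct) (simp_all add: mpoly_carrier_intros)

lemma vectorspace_mpoly_ring: "vectorspace (class_ring :: 'a::field ring) (mpoly_ring n)"
proof (rule vs_criteria)
  let ?R = "mpoly_ring n :: ('a, (nat \<Rightarrow>\<^sub>0 nat) \<Rightarrow>\<^sub>0 'a) module"
  show "\<forall>v\<in>carrier ?R. \<exists>w\<in>carrier ?R. v \<oplus>\<^bsub>?R\<^esub> w = \<zero>\<^bsub>?R\<^esub>"
  proof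
    fix v
    assume "v \<in> carrier ?R"
    then have "- v \<in> carrier ?R \<and> v \<oplus>\<^bsub>?R\<^esub> - v = \<zero>\<^bsub>?R\<^esub>"
      using mpoly_carrier_uminus by (simp add: mpoly_ring_simps(2-))
    then show "\<exists>w\<in>carrier ?R. v \<oplus>\<^bsub>?R\<^esub> w = \<zero>\<^bsub>?R\<^esub>"
      by blast
  qed
qed (simp_all add: class_field mpoly_ring_simps(2-) mpoly_carrier_intros scale_scale scale_one
    scale_add_left scale_add_right add_ac)

lemma ring_mpoly_ring: "ring (mpoly_ring n :: ('a::field, (nat \<Rightarrow>\<^sub>0 nat) \<Rightarrow>\<^sub>0 'a) module)"
proof (rule ringI)
  show "abelian_group (mpoly_ring n :: ('a, (nat \<Rightarrow>\<^sub>0 nat) \<Rightarrow>\<^sub>0 'a) module)"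
    using vectorspace_mpoly_ring by (intro module.axioms(2) vectorspace.axioms(1))
  show "Group.monoid (mpoly_ring n :: ('a, (nat \<Rightarrow>\<^sub>0 nat) \<Rightarrow>\<^sub>0 'a) module)"
    by (rule monoidI) (simp_all add: mpoly_ring_simps(2-) mpoly_carrier_intros mult.assoc)
qed (simp_all add: mpoly_ring_simps(2-) distrib_left distrib_right)

text \<open>The value of a polynomial at the vertex of the unit cube with support \<open>S\<close>: there a monomial
  is \<open>1\<close> or \<open>0\<close> according to whether all of its indeterminates lie in \<open>S\<close>.\<close>

definition vertex_eval :: "nat set \<Rightarrow> ((nat \<Rightarrow>\<^sub>0 nat) \<Rightarrow>\<^sub>0 'a) \<Rightarrow> 'a::field" where
  "vertex_eval S = linear_ext (\<lambda>m. of_bool (Poly_Mapping.keys m \<subseteq> S))"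

text \<open>Natural exponents cannot cancel. This is what makes the value of a monomial at a vertex
  multiplicative.\<close>

lemma keys_add_nat:
  "Poly_Mapping.keys (m + m' :: 'x \<Rightarrow>\<^sub>0 nat) = Poly_Mapping.keys m \<union> Poly_Mapping.keys m'"
  by (auto simp: in_keys_iff lookup_add)

lemma vertex_eval_mult: "vertex_eval S (p * q) = vertex_eval S p * vertex_eval S q"
  unfolding vertex_eval_def by (rule linear_ext_mult) (simp add: keys_add_nat)

lemma vertex_eval_single:
  "vertex_eval S (Poly_Mapping.single m c) = c * of_bool (Poly_Mapping.keys m \<subseteq> S)"
  by (simp add: vertex_eval_def)

lemma vertex_eval_indet: "vertex_eval S (indet i) = of_bool (i \<in> S)"
  by (simp add: indet_def vertex_eval_single)

lemma vertex_eval_one: "vertex_eval S 1 = 1"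
  by (simp add: vertex_eval_def linear_ext_one)

lemma vertex_eval_zero: "vertex_eval S 0 = 0"
  by (simp add: vertex_eval_def)

lemma vertex_eval_add: "vertex_eval S (p + q) = vertex_eval S p + vertex_eval S q"
  and vertex_eval_diff: "vertex_eval S (p - q) = vertex_eval S p - vertex_eval S q"
  and vertex_eval_scale: "vertex_eval S (scale c p) = c * vertex_eval S p"
  and vertex_eval_sum: "vertex_eval S (\<Sum>x\<in>A. r x) = (\<Sum>x\<in>A. vertex_eval S (r x))"
  by (simp_all add: vertex_eval_def linear_ext_add linear_ext_diff linear_ext_scale linear_ext_sum)

lemma vertex_eval_prod: "vertex_eval S (\<Prod>x\<in>A. r x) = (\<Prod>x\<in>A. vertex_eval S (r x))"
  by (induction A rule: infinite_finite_induct) (simp_all add: vertex_eval_one vertex_eval_mult)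

text \<open>Lagrange polynomial of the vertex \<open>S\<close>: value 1 there and 0 at the other
  vertices. Idempotence holds for its class modulo the relations.\<close>

definition vertex_idempotent :: "nat \<Rightarrow> nat set \<Rightarrow> (nat \<Rightarrow>\<^sub>0 nat) \<Rightarrow>\<^sub>0 'a::field" where
  "vertex_idempotent n S = (\<Prod>i\<in>S. indet i) * (\<Prod>i\<in>{1..n} - S. 1 - indet i)"

text \<open>Expand the product over \<open>i\<close> of \<open>indet i + (1 - indet i)\<close>,
  whose factors are all 1. The identity holds already before passing to the quotient.\<close>

lemma sum_vertex_idempotent: "(\<Sum>S\<in>Pow {1..n}. vertex_idempotent n S) = 1"
  using prod_add[of "{1..n}" indet "\<lambda>i. 1 - indet i"] by (simp add: vertex_idempotent_def)

lemma mpoly_carrier_vertex_idempotent: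
  "S \<subseteq> {1..n} \<Longrightarrow> vertex_idempotent n S \<in> carrier (mpoly_ring n)"
  unfolding vertex_idempotent_def
  by (intro mpoly_carrier_mult mpoly_carrier_prod mpoly_carrier_diff mpoly_carrier_one
      mpoly_carrier_indet) auto

text \<open>An index in \<open>S\<close> but not in \<open>T\<close> makes a factor
  \<open>indet i\<close> vanish, one in \<open>T\<close> but not in \<open>S\<close> a factor
  \<open>1 - indet i\<close>.\<close>

lemma vertex_eval_vertex_idempotent:
  assumes "S \<subseteq> {1..n}" "T \<subseteq> {1..n}"
  shows "vertex_eval T (vertex_idempotent n S) = (of_bool (S = T) :: 'a::field)"
proof -
  have eval: "vertex_eval T (vertex_idempotent n S) =
      (\<Prod>i\<in>S. of_bool (i \<in> T) :: 'a) * (\<Prod>i\<in>{1..n} - S. 1 - of_bool (i \<in> T))"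
    by (simp add: vertex_idempotent_def vertex_eval_mult vertex_eval_prod vertex_eval_diff
        vertex_eval_one vertex_eval_indet)
  have S: "finite S"
    using assms(1) by (rule finite_subset) simp
  consider "S = T" | i where "i \<in> S" "i \<notin> T" | i where "i \<in> T" "i \<in> {1..n} - S"
    using assms by blast
  then show ?thesis
  proof cases
    case 1
    with eval show ?thesis
      by simp
  next
    case 2
    then have "(\<Prod>i\<in>S. of_bool (i \<in> T)) = (0 :: 'a)"
      using S by (intro prod_zero) auto
    then show ?thesis
      using 2 by (auto simp: eval)
  next
    case 3
    then have "(\<Prod>i\<in>{1..n} - S. 1 - of_bool (i \<in> T)) = (0 :: 'a)"
      by (intro prod_zero) auto
    then show ?thesis
      using 3 by (auto simp: eval)
  qed
qed

section \<open>The idempotence ideal as common kernel of the evaluations\<close>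

locale idempotent_ideal =
  fixes n :: nat and ty :: "'a::field itself"
begin

abbreviation R :: "('a, (nat \<Rightarrow>\<^sub>0 nat) \<Rightarrow>\<^sub>0 'a) module" where
  "R \<equiv> mpoly_ring n"
definition relators :: "((nat \<Rightarrow>\<^sub>0 nat) \<Rightarrow>\<^sub>0 'a) set" where
  "relators = {indet i ^ 2 - indet i | i. i \<in> {1..n}}"
definition J :: "((nat \<Rightarrow>\<^sub>0 nat) \<Rightarrow>\<^sub>0 'a) set" where
  "J = Idl\<^bsub>R\<^esub> relators"

lemma relators_subset: "relators \<subseteq> carrier R"
  by (auto simp: relators_def power2_eq_square simp del: One_nat_def intro!: mpoly_carrier_diff
      mpoly_carrier_mult mpoly_carrier_indet)

lemma ideal_J: "ideal J R"
  unfolding J_def using ring_mpoly_ring relators_subset by (rule ring.genideal_ideal)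

lemma J_add: "p \<in> J \<Longrightarrow> q \<in> J \<Longrightarrow> p + q \<in> J"
  using additive_subgroup.a_closed[OF ideal.axioms(1)[OF ideal_J]] by (simp add: mpoly_ring_simps)

lemma J_zero: "0 \<in> J"
  using additive_subgroup.zero_closed[OF ideal.axioms(1)[OF ideal_J]] by (simp add: mpoly_ring_simps)

lemma J_mult: "p \<in> J \<Longrightarrow> q \<in> carrier R \<Longrightarrow> q * p \<in> J"
  using ideal.I_l_closed[OF ideal_J] by (simp add: mpoly_ring_simps(2-))

lemma J_sum: "(\<And>x. x \<in> A \<Longrightarrow> p x \<in> J) \<Longrightarrow> (\<Sum>x\<in>A. p x) \<in> J"
  by (induction A rule: infinite_finite_induct) (auto simp: J_add J_zero)

lemma relator_in_J: "i \<in> {1..n} \<Longrightarrow> indet i ^ 2 - indet i \<in> J"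
  using ring.genideal_self[OF ring_mpoly_ring relators_subset] unfolding J_def relators_def by blast

text \<open>The idempotent has the factor \<open>indet i\<close> or \<open>1 - indet i\<close>, so
  the difference is a multiple of the relator \<open>indet i ^ 2 - indet i\<close>. Constants are
  encoded as coefficients at the trivial monomial 0.\<close>

lemma indet_mult_vertex_idempotent:
  assumes S: "S \<subseteq> {1..n}" and i: "i \<in> {1..n}"
  shows "indet i * vertex_idempotent n S
    - Poly_Mapping.single 0 (of_bool (i \<in> S)) * vertex_idempotent n S \<in> J"
proof (cases "i \<in> S")
  case True
  define q :: "(nat \<Rightarrow>\<^sub>0 nat) \<Rightarrow>\<^sub>0 'a"
    where "q = (\<Prod>j\<in>S - {i}. indet j) * (\<Prod>j\<in>{1..n} - S. 1 - indet j)"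
  have "finite S"
    using S by (rule finite_subset) simp
  then have "vertex_idempotent n S = indet i * q"
    using True by (simp add: vertex_idempotent_def q_def prod.remove[of S i] mult.assoc)
  moreover have "q \<in> carrier R"
    unfolding q_def using S
    by (intro mpoly_carrier_mult mpoly_carrier_prod mpoly_carrier_diff mpoly_carrier_one
        mpoly_carrier_indet) auto
  ultimately show ?thesis
    using J_mult[OF relator_in_J[OF i], of q] True
    by (simp add: power2_eq_square algebra_simps)
next
  case False
  define q :: "(nat \<Rightarrow>\<^sub>0 nat) \<Rightarrow>\<^sub>0 'a"
    where "q = (\<Prod>j\<in>S. indet j) * (\<Prod>j\<in>{1..n} - S - {i}. 1 - indet j)"
  have idem: "vertex_idempotent n S = (1 - indet i) * q"
    unfolding vertex_idempotent_def q_def using False i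
    by (subst prod.remove[of "{1..n} - S" i]) (simp_all add: mult_ac)
  \<comment> \<open>The sign enters because \<open>indet i * (1 - indet i)\<close> is the negative
    of the relator.\<close>
  have "- q \<in> carrier R"
    unfolding q_def using S
    by (intro mpoly_carrier_mult mpoly_carrier_prod mpoly_carrier_diff mpoly_carrier_one
        mpoly_carrier_uminus mpoly_carrier_indet) auto
  then show ?thesis
    unfolding idem using J_mult[OF relator_in_J[OF i], of "- q"] False
    by (simp add: power2_eq_square algebra_simps)
qed

text \<open>Modulo \<open>J\<close>, multiplication by \<open>p\<close> scales the idempotent by the
  value of \<open>p\<close> at the vertex. Carrier membership is included because products need
  \<open>J\<close> to absorb the factor \<open>p\<close>.\<close>

definition acts_by_value :: "nat set \<Rightarrow> ((nat \<Rightarrow>\<^sub>0 nat) \<Rightarrow>\<^sub>0 'a) \<Rightarrow> bool" where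
  "acts_by_value S p \<longleftrightarrow> p \<in> carrier R \<and>
    p * vertex_idempotent n S - Poly_Mapping.single 0 (vertex_eval S p) * vertex_idempotent n S \<in> J"

lemma acts_by_value_add:
  assumes "acts_by_value S p" "acts_by_value S q"
  shows "acts_by_value S (p + q)"
proof -
  let ?e = "vertex_idempotent n S"
    and ?c = "\<lambda>p. Poly_Mapping.single (0 :: nat \<Rightarrow>\<^sub>0 nat) (vertex_eval S p)"
  have "(p + q) * ?e - ?c (p + q) * ?e = (p * ?e - ?c p * ?e) + (q * ?e - ?c q * ?e)"
    by (simp add: vertex_eval_add single_add algebra_simps)
  then show ?thesis
    using assms J_add mpoly_carrier_add unfolding acts_by_value_def by metis
qed

lemma acts_by_value_mult:
  assumes "acts_by_value S p" "acts_by_value S q"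
  shows "acts_by_value S (p * q)"
proof -
  let ?e = "vertex_idempotent n S"
    and ?c = "\<lambda>p. Poly_Mapping.single (0 :: nat \<Rightarrow>\<^sub>0 nat) (vertex_eval S p)"
  have "?c (p * q) = ?c p * ?c q"
    by (simp add: vertex_eval_mult mult_single)
  \<comment> \<open>First \<open>q\<close>, then \<open>p\<close> is replaced by its value.\<close>
  then have "(p * q) * ?e - ?c (p * q) * ?e =
      p * (q * ?e - ?c q * ?e) + ?c q * (p * ?e - ?c p * ?e)"
    by (simp add: algebra_simps)
  moreover have "?c q \<in> carrier R"
    by (intro mpoly_carrier_single) simp
  ultimately show ?thesis
    using assms J_add J_mult mpoly_carrier_mult unfolding acts_by_value_def by metis
qed

lemma acts_by_value_const: "acts_by_value S (Poly_Mapping.single 0 c)"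
  by (simp add: acts_by_value_def vertex_eval_single J_zero mpoly_carrier_single)

lemma acts_by_value_indet: "S \<subseteq> {1..n} \<Longrightarrow> i \<in> {1..n} \<Longrightarrow> acts_by_value S (indet i)"
  unfolding acts_by_value_def vertex_eval_indet
  by (intro conjI indet_mult_vertex_idempotent mpoly_carrier_indet)

lemma acts_by_value_indet_power:
  assumes "S \<subseteq> {1..n}" "i \<in> {1..n}"
  shows "acts_by_value S (Poly_Mapping.single (Poly_Mapping.single i k) 1)"
proof (induction k)
  case 0
  then show ?case
    using acts_by_value_const[of S 1] by simp
next
  case (Suc k)
  have "Poly_Mapping.single (Poly_Mapping.single i (Suc k)) (1 :: 'a) =
      indet i * Poly_Mapping.single (Poly_Mapping.single i k) 1"
    by (simp add: indet_def mult_single flip: single_add)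
  then show ?case
    using acts_by_value_mult[OF acts_by_value_indet[OF assms] Suc] by simp
qed

text \<open>The induction runs over the exponent function: splitting off one key factors out a pure
  power of one indeterminate.\<close>

lemma acts_by_value_monomial:
  assumes "S \<subseteq> {1..n}" "Poly_Mapping.keys m \<subseteq> {1..n}"
  shows "acts_by_value S (Poly_Mapping.single m 1)"
  using assms(2)
proof (induction m rule: poly_mapping_induct)
  case zero
  then show ?case
    using acts_by_value_const[of S 1] by simp
next
  case (add m i k)
  have "acts_by_value S (Poly_Mapping.single (Poly_Mapping.single i k) 1 * Poly_Mapping.single m 1)"
    using add.prems keys_single_add[OF add.hyps] assms(1)
    by (intro acts_by_value_mult acts_by_value_indet_power add.IH) auto
  then show ?case
    by (simp add: mult_single)
qed

text \<open>Constants and monomials act by value and sums and products preserve this; now the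
  induction runs over the coefficient function.\<close>

lemma acts_by_value:
  assumes "S \<subseteq> {1..n}" "p \<in> carrier R"
  shows "acts_by_value S p"
  using assms(2)
proof (induction p rule: poly_mapping_induct)
  case zero
  then show ?case
    using acts_by_value_const[of S 0] by simp
next
  case (add p m c)
  have mem: "Poly_Mapping.keys m \<subseteq> {1..n}" "p \<in> carrier R"
    using add.prems keys_single_add[OF add.hyps] by (auto simp: mpoly_ring_simps)
  have "acts_by_value S (Poly_Mapping.single 0 c * Poly_Mapping.single m 1 + p)"
    by (intro acts_by_value_add acts_by_value_mult acts_by_value_const
        acts_by_value_monomial assms(1) mem add.IH)
  then show ?case
    by (simp add: mult_single)
qed

text \<open>The evaluations are multiplicative, so their common kernel is an ideal; it contains the
  relators because 0 and 1 are idempotent. Conversely, if all values of \<open>p\<close> vanish,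
  each \<open>p * vertex_idempotent n S\<close> lies in \<open>J\<close>, and these products sum to
  \<open>p\<close>.\<close>

lemma J_eq: "J = {p \<in> carrier R. \<forall>S\<in>Pow {1..n}. vertex_eval S p = 0}"
    (is "_ = ?K")
proof
  have "ideal ?K R"
  proof (rule idealI[OF ring_mpoly_ring])
    have "a_inv R p = - p" if "p \<in> carrier R" for p
      using that mpoly_carrier_uminus[OF that]
      by (intro abelian_group.minus_equality[OF ring.is_abelian_group[OF ring_mpoly_ring]])
        (simp_all add: mpoly_ring_simps(2-))
    then have inv: "inv\<^bsub>add_monoid R\<^esub> p = - p" if "p \<in> carrier R" for p
      using that by (simp add: a_inv_def)
    have "group (add_monoid R)"
      using ring.is_abelian_group[OF ring_mpoly_ring] by (rule abelian_group.a_group)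
    then show "subgroup ?K (add_monoid R)"
    proof (rule group.subgroupI)
      show "?K \<noteq> {}"
        using mpoly_carrier_zero vertex_eval_zero by blast
      show "inv\<^bsub>add_monoid R\<^esub> p \<in> ?K" if "p \<in> ?K" for p
        using that mpoly_carrier_uminus[of p n] vertex_eval_diff[of _ 0 p]
        by (simp add: inv vertex_eval_zero)
    qed (auto simp: mpoly_ring_simps(2-) mpoly_carrier_add vertex_eval_add)
  qed (auto simp: mpoly_ring_simps(2-) mpoly_carrier_mult vertex_eval_mult)
  moreover have "relators \<subseteq> ?K"
    using relators_subset
    by (auto simp: relators_def power2_eq_square vertex_eval_diff vertex_eval_mult vertex_eval_indet)
  ultimately show "J \<subseteq> ?K"
    unfolding J_def by (rule ring.genideal_minimal[OF ring_mpoly_ring])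
  show "?K \<subseteq> J"
  proof
    fix p
    assume p: "p \<in> ?K"
    have "p * vertex_idempotent n S \<in> J" if "S \<in> Pow {1..n}" for S
      using acts_by_value[of S p] p that by (simp add: acts_by_value_def)
    then have "(\<Sum>S\<in>Pow {1..n}. p * vertex_idempotent n S) \<in> J"
      by (rule J_sum)
    then show "p \<in> J"
      by (simp only: sum_distrib_left[symmetric] sum_vertex_idempotent mult_1_right)
  qed
qed

lemma vs_isomorphic_idempotent_mpoly_quot_diag:
  "vs_isomorphic (class_ring :: 'a ring) (idempotent_mpoly_quot n) (diag_mat_space TYPE('a) (2 ^ n))"
  unfolding idempotent_mpoly_quot_def J_def[unfolded relators_def, symmetric] J_eq
proof (rule vs_isomorphic_quot_module_diag_mat_space)
  fix a :: "nat set \<Rightarrow> 'a"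
  \<comment> \<open>Lagrange interpolation of the values \<open>a\<close>.\<close>
  define v where "v = (\<Sum>S\<in>Pow {1..n}. scale (a S) (vertex_idempotent n S))"
  have "v \<in> carrier R"
    unfolding v_def
    by (intro mpoly_carrier_sum mpoly_carrier_scale mpoly_carrier_vertex_idempotent) simp
  moreover have "vertex_eval S v = a S" if "S \<in> Pow {1..n}" for S
  proof -
    have "vertex_eval S v = (\<Sum>T\<in>Pow {1..n}. if S = T then a T else 0)"
      unfolding v_def vertex_eval_sum using that
      by (intro sum.cong) (auto simp: vertex_eval_scale vertex_eval_vertex_idempotent)
    then show ?thesis
      using that by simp
  qed
  ultimately show "\<exists>v\<in>carrier R. \<forall>S\<in>Pow {1..n}. vertex_eval S v = a S"
    by blast
qed (use vectorspace_mpoly_ring in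
    \<open>auto simp: card_Pow mpoly_ring_simps(2-) vertex_eval_add vertex_eval_scale\<close>)

end

theorem lemma1:
  fixes n :: nat
  assumes "n \<ge> 1"
  shows "vs_isomorphic (class_ring :: complex ring)
           (idempotent_mpoly_quot n) (tensor_power (module_vec TYPE(complex) 2) n) \<and>
         vs_isomorphic (class_ring :: complex ring)
           (tensor_power (module_vec TYPE(complex) 2) n) (diag_mat_space TYPE(complex) (2 ^ n))"
  \<comment> \<open>The first claim composes the isomorphism from polynomials to diagonal matrices
    with the inverse of the one from tensors.\<close>
  using idempotent_ideal.vs_isomorphic_idempotent_mpoly_quot_diag
    binary_tensor_power.vs_isomorphic_tensor_power_diag
    vs_isomorphic_sym vs_isomorphic_trans by blast

end
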